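(* Let $M$ be a finite set, $\mathcal L$ a nonempty family of subsets of $M$ which is a lattice under inclusion, with join $\lor$ and meet $\land$ (so $Z_1\lor Z_2\supseteq Z_1\cup Z_2$ and $Z_1\land Z_2\subseteq Z_1\cap Z_2$), let $r:\mathcal L\to\mathbb R_{\ge0}$, and let $\mu$ be a measure on $M$. Suppose that for every pair of incomparable $Z_1,Z_2\in\mathcal L$, $$r(Z_1)+r(Z_2)\ge r(Z_1\land Z_2)+r(Z_1\lor Z_2)+\mu\big((Z_1\cap Z_2)\setminus(Z_1\land Z_2)\big).$$ Then the function $r*\mu$ defined on subsets $A\subseteq M$ by $(r*\mu)(A)=\min\{r(Z)+\mu(A\setminus Z): Z\in\mathcal L\}$ is the rank function of a polymatroid on $M$ (non-negative, monotone and submodular).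
   Context: A (discrete) measure on a finite set $M$ is a non-negative additive function on subsets of $M$, i.e. $\mu(A)=\sum_{a\in A}\mu(a)$ with $\mu(a)\ge0$. A polymatroid is a non-negative, monotone, submodular real function on subsets of a finite set. The pair $(r,\mathcal L)$ is called a ranked lattice and $r*\mu$ its convolution with $\mu$. *)

theory Defs
  imports Complex_Main "HOL-Algebra.Lattice"
begin

text \<open>
  Set functions on (a family of) subsets of a ground set \<open>M\<close> are total functions
  on \<open>'a set\<close>; only their values on the relevant subsets are ever constrained or used.
\<close>

definition discrete_measure :: "'a set \<Rightarrow> ('a set \<Rightarrow> real) \<Rightarrow> bool" where
  "discrete_measure M \<mu> \<longleftrightarrow>
     (\<forall>a\<in>M. 0 \<le> \<mu> {a}) \<and> (\<forall>A\<subseteq>M. \<mu> A = (\<Sum>a\<in>A. \<mu> {a}))"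

text \<open>Normalisation at the empty set is not required.\<close>

definition polymatroid :: "'a set \<Rightarrow> ('a set \<Rightarrow> real) \<Rightarrow> bool" where
  "polymatroid M f \<longleftrightarrow>
     finite M \<and>
     (\<forall>A\<subseteq>M. 0 \<le> f A) \<and>
     mono_on (Pow M) f \<and>
     (\<forall>A\<subseteq>M. \<forall>B\<subseteq>M. f (A \<inter> B) + f (A \<union> B) \<le> f A + f B)"

text \<open>
  A family of sets as an ordered structure under inclusion. Its meets and joins are
  infima and suprema taken within the family, and in general differ from
  intersections and unions.
\<close>

definition incl_order :: "'a set set \<Rightarrow> 'a set gorder" where
  "incl_order \<L> = \<lparr>carrier = \<L>, eq = (=), le = (\<subseteq>)\<rparr>"

text \<open>The minimum is meaningful when \<open>\<L>\<close> is finite and nonempty.\<close>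

definition convolution ::
  "'a set set \<Rightarrow> ('a set \<Rightarrow> real) \<Rightarrow> ('a set \<Rightarrow> real) \<Rightarrow> 'a set \<Rightarrow> real" where
  "convolution \<L> r \<mu> A = Min ((\<lambda>Z. r Z + \<mu> (A - Z)) ` \<L>)"

end

theory Submission
  imports Defs
begin

text \<open>
  Let \<open>Z1\<close> and \<open>Z2\<close> attain the minima defining \<open>(r*\<mu>)(A)\<close> and \<open>(r*\<mu>)(B)\<close>. The hypothesis
  uncrosses them: there are \<open>W \<subseteq> Z1 \<inter> Z2\<close> and \<open>J \<supseteq> Z1 \<union> Z2\<close> in the lattice (meet and join, or
  \<open>Z1\<close> and \<open>Z2\<close> themselves when these are comparable) with
  \<open>r W + r J + \<mu> (Z1 \<inter> Z2 - W) \<le> r Z1 + r Z2\<close>. Using \<open>W\<close> as a candidate for \<open>A \<inter> B\<close> and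
  \<open>J\<close> for \<open>A \<union> B\<close>, submodularity reduces to an inequality between measures that holds
  pointwise.
\<close>

lemma discrete_measure_singleton_nonneg:
  assumes "discrete_measure M \<mu>" "a \<in> M"
  shows "0 \<le> \<mu> {a}"
  using assms unfolding discrete_measure_def by blast

lemma discrete_measure_sum:
  assumes "discrete_measure M \<mu>" "A \<subseteq> M"
  shows "\<mu> A = (\<Sum>a\<in>A. \<mu> {a})"
  using assms unfolding discrete_measure_def by blast

text \<open>Writing every measure as a sum over the same index set \<open>M\<close> lets
  inequalities between several measures be checked point by point.\<close>

lemma discrete_measure_indicator:
  assumes "finite M" "discrete_measure M \<mu>" "A \<subseteq> M"
  shows "\<mu> A = (\<Sum>a\<in>M. if a \<in> A then \<mu> {a} else 0)"
proof -
  have "\<mu> A = (\<Sum>a\<in>M \<inter> A. \<mu> {a})"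
    unfolding Int_absorb1[OF assms(3)] by (rule discrete_measure_sum[OF assms(2,3)])
  then show ?thesis
    unfolding sum.inter_restrict[OF assms(1)] .
qed

lemma discrete_measure_nonneg:
  assumes "discrete_measure M \<mu>" "A \<subseteq> M"
  shows "0 \<le> \<mu> A"
  unfolding discrete_measure_sum[OF assms]
  using assms by (intro sum_nonneg discrete_measure_singleton_nonneg[OF assms(1)]) auto

lemma discrete_measure_mono:
  assumes "finite M" "discrete_measure M \<mu>" "A \<subseteq> B" "B \<subseteq> M"
  shows "\<mu> A \<le> \<mu> B"
proof -
  have "A \<subseteq> M"
    using assms by blast
  moreover have "(\<Sum>a\<in>A. \<mu> {a}) \<le> (\<Sum>a\<in>B. \<mu> {a})"
    using assms
    by (intro sum_mono2 discrete_measure_singleton_nonneg[OF assms(2)]) (auto intro: finite_subset)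
  ultimately show ?thesis
    using discrete_measure_sum[OF assms(2)] assms(4) by metis
qed

text \<open>Each point of \<open>M\<close> lies in at least as many of the sets on the right as of
  those on the left, and point weights are non-negative.\<close>

lemma discrete_measure_uncross:
  assumes "finite M" "discrete_measure M \<mu>" "A \<subseteq> M" "B \<subseteq> M"
    and "Z1 \<subseteq> M" "Z1 \<union> Z2 \<subseteq> J"
  shows "\<mu> (A \<inter> B - W) + \<mu> (A \<union> B - J) \<le> \<mu> (A - Z1) + \<mu> (B - Z2) + \<mu> (Z1 \<inter> Z2 - W)"
proof -
  let ?g = "\<lambda>S a. if a \<in> S then \<mu> {a} else 0"
  have sub: "A \<inter> B - W \<subseteq> M" "A \<union> B - J \<subseteq> M" "A - Z1 \<subseteq> M" "B - Z2 \<subseteq> M" "Z1 \<inter> Z2 - W \<subseteq> M"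
    using assms by auto
  have "(\<Sum>a\<in>M. ?g (A \<inter> B - W) a + ?g (A \<union> B - J) a)
      \<le> (\<Sum>a\<in>M. ?g (A - Z1) a + ?g (B - Z2) a + ?g (Z1 \<inter> Z2 - W) a)"
  proof (rule sum_mono)
    fix a
    assume "a \<in> M"
    then have "0 \<le> \<mu> {a}"
      by (rule discrete_measure_singleton_nonneg[OF assms(2)])
    \<comment> \<open>A point outside \<open>J\<close> is outside \<open>Z1\<close> and
      \<open>Z2\<close>, so \<open>A - Z1\<close> and \<open>B - Z2\<close> count it as often as
      \<open>A\<close> and \<open>B\<close> do. A point of \<open>J\<close> counts on the left at
      most once, when in \<open>A \<inter> B - W\<close>; then it misses \<open>Z1\<close>, misses
      \<open>Z2\<close>, or lies in \<open>Z1 \<inter> Z2 - W\<close>.\<close>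
    then show "?g (A \<inter> B - W) a + ?g (A \<union> B - J) a
        \<le> ?g (A - Z1) a + ?g (B - Z2) a + ?g (Z1 \<inter> Z2 - W) a"
      using assms(6) by auto
  qed
  then show ?thesis
    by (simp add: sum.distrib sub[THEN discrete_measure_indicator[OF assms(1,2)]])
qed

text \<open>Translates the abstract lattice laws into membership and inclusion, as needed to use
  meet and join as \<open>W\<close> and \<open>J\<close>.\<close>

lemma incl_order_lattice:
  assumes "lattice (incl_order \<L>)" "Z1 \<in> \<L>" "Z2 \<in> \<L>"
  shows "Z1 \<sqinter>\<^bsub>incl_order \<L>\<^esub> Z2 \<in> \<L>" "Z1 \<squnion>\<^bsub>incl_order \<L>\<^esub> Z2 \<in> \<L>"
    and "Z1 \<union> Z2 \<subseteq> Z1 \<squnion>\<^bsub>incl_order \<L>\<^esub> Z2"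
proof -
  interpret lattice "incl_order \<L>" by fact
  have "Z1 \<in> carrier (incl_order \<L>)" "Z2 \<in> carrier (incl_order \<L>)"
    using assms by (simp_all add: incl_order_def)
  then show "Z1 \<sqinter>\<^bsub>incl_order \<L>\<^esub> Z2 \<in> \<L>" "Z1 \<squnion>\<^bsub>incl_order \<L>\<^esub> Z2 \<in> \<L>"
    "Z1 \<union> Z2 \<subseteq> Z1 \<squnion>\<^bsub>incl_order \<L>\<^esub> Z2"
    using meet_closed[of Z1 Z2] join_closed[of Z1 Z2] join_left[of Z1 Z2] join_right[of Z1 Z2]
    by (simp_all add: incl_order_def)
qed

lemma convolution_le:
  assumes "finite \<L>" "Z \<in> \<L>"
  shows "convolution \<L> r \<mu> A \<le> r Z + \<mu> (A - Z)"
  unfolding convolution_def using assms by (intro Min_le) auto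

lemma convolution_attained:
  assumes "finite \<L>" "\<L> \<noteq> {}"
  obtains Z where "Z \<in> \<L>" "convolution \<L> r \<mu> A = r Z + \<mu> (A - Z)"
proof -
  have "convolution \<L> r \<mu> A \<in> (\<lambda>Z. r Z + \<mu> (A - Z)) ` \<L>"
    unfolding convolution_def using assms by (intro Min_in) auto
  then show thesis
    using that by blast
qed

theorem theorem2:
  fixes M :: "'a set" and \<L> :: "'a set set" and r \<mu> :: "'a set \<Rightarrow> real"
  assumes "finite M"
    and "\<L> \<noteq> {}" and "\<L> \<subseteq> Pow M"
    and "lattice (incl_order \<L>)"
    and "\<And>Z. Z \<in> \<L> \<Longrightarrow> 0 \<le> r Z"
    and "discrete_measure M \<mu>"
    and "\<And>Z1 Z2. Z1 \<in> \<L> \<Longrightarrow> Z2 \<in> \<L> \<Longrightarrow> \<not> Z1 \<subseteq> Z2 \<Longrightarrow> \<not> Z2 \<subseteq> Z1 \<Longrightarrow>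
      r Z1 + r Z2 \<ge> r (Z1 \<sqinter>\<^bsub>incl_order \<L>\<^esub> Z2) + r (Z1 \<squnion>\<^bsub>incl_order \<L>\<^esub> Z2)
        + \<mu> ((Z1 \<inter> Z2) - (Z1 \<sqinter>\<^bsub>incl_order \<L>\<^esub> Z2))"
  shows "polymatroid M (convolution \<L> r \<mu>)"
proof -
  \<comment> \<open>Finiteness makes \<open>Min\<close> in the convolution a minimum that is
    attained.\<close>
  have fin: "finite \<L>"
    using assms(1,3) by (simp add: finite_subset)
  have nonneg: "0 \<le> convolution \<L> r \<mu> A" if "A \<subseteq> M" for A
  proof -
    obtain Z where "Z \<in> \<L>" "convolution \<L> r \<mu> A = r Z + \<mu> (A - Z)"
      by (rule convolution_attained[OF fin assms(2)])
    moreover have "0 \<le> \<mu> (A - Z)"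
      using that by (intro discrete_measure_nonneg[OF assms(6)]) auto
    ultimately show ?thesis
      using assms(5) by simp
  qed
  have mono: "convolution \<L> r \<mu> A \<le> convolution \<L> r \<mu> B" if "A \<subseteq> B" "B \<subseteq> M" for A B
  proof -
    \<comment> \<open>A minimiser for the larger set is a candidate for the smaller one.\<close>
    obtain Z where Z: "Z \<in> \<L>" "convolution \<L> r \<mu> B = r Z + \<mu> (B - Z)"
      by (rule convolution_attained[OF fin assms(2)])
    have "\<mu> (A - Z) \<le> \<mu> (B - Z)"
      using that by (intro discrete_measure_mono[OF assms(1,6)]) auto
    with Z convolution_le[OF fin Z(1), of r \<mu> A] show ?thesis
      by linarith
  qed
  have uncross: "\<exists>W\<in>\<L>. \<exists>J\<in>\<L>. Z1 \<union> Z2 \<subseteq> J \<and> r W + r J + \<mu> (Z1 \<inter> Z2 - W) \<le> r Z1 + r Z2"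
    if Z: "Z1 \<in> \<L>" "Z2 \<in> \<L>" for Z1 Z2
  proof -
    have "\<mu> {} = 0"
      using discrete_measure_sum[OF assms(6), of "{}"] by simp
    \<comment> \<open>For nested sets the smaller serves as \<open>W\<close> and the larger as
      \<open>J\<close>: then \<open>Z1 \<inter> Z2 = W\<close>, so the correction term is
      \<open>\<mu> {}\<close>. The unordered pair covers both directions of inclusion.\<close>
    then have comparable: "\<exists>W\<in>\<L>. \<exists>J\<in>\<L>. Z1 \<union> Z2 \<subseteq> J \<and> r W + r J + \<mu> (Z1 \<inter> Z2 - W) \<le> r Z1 + r Z2"
      if "W \<in> \<L>" "J \<in> \<L>" "W \<subseteq> J" "{W, J} = {Z1, Z2}" for W J
    proof -
      have "Z1 \<inter> Z2 - W = {}" "Z1 \<union> Z2 \<subseteq> J" "r W + r J = r Z1 + r Z2"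
        using that by (auto simp: doubleton_eq_iff)
      then show ?thesis
        using that(1,2) \<open>\<mu> {} = 0\<close> by (metis add_0_right order_refl)
    qed
    consider "Z1 \<subseteq> Z2" | "Z2 \<subseteq> Z1" | "\<not> Z1 \<subseteq> Z2" "\<not> Z2 \<subseteq> Z1"
      by blast
    then show ?thesis
    proof cases
      case 1
      with Z comparable[of Z1 Z2] show ?thesis by simp
    next
      case 2
      with Z comparable[of Z2 Z1] show ?thesis by (simp add: insert_commute)
    next
      case 3
      \<comment> \<open>Here \<open>W\<close> is the meet and \<open>J\<close> the join.\<close>
      with assms(7)[OF Z] incl_order_lattice[OF assms(4) Z] show ?thesis by blast
    qed
  qed
  have submodular: "convolution \<L> r \<mu> (A \<inter> B) + convolution \<L> r \<mu> (A \<union> B)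
      \<le> convolution \<L> r \<mu> A + convolution \<L> r \<mu> B" if "A \<subseteq> M" "B \<subseteq> M" for A B
  proof -
    obtain Z1 where Z1: "Z1 \<in> \<L>" "convolution \<L> r \<mu> A = r Z1 + \<mu> (A - Z1)"
      by (rule convolution_attained[OF fin assms(2)])
    obtain Z2 where Z2: "Z2 \<in> \<L>" "convolution \<L> r \<mu> B = r Z2 + \<mu> (B - Z2)"
      by (rule convolution_attained[OF fin assms(2)])
    obtain W J where WJ: "W \<in> \<L>" "J \<in> \<L>" "Z1 \<union> Z2 \<subseteq> J"
      "r W + r J + \<mu> (Z1 \<inter> Z2 - W) \<le> r Z1 + r Z2"
      using uncross[OF Z1(1) Z2(1)] by blast
    have "Z1 \<subseteq> M"
      using Z1(1) assms(3) by blast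
    \<comment> \<open>On adding these inequalities, the term
      \<open>\<mu> (Z1 \<inter> Z2 - W)\<close> from the measure bound cancels against the one in
      \<open>WJ(4)\<close>.\<close>
    from discrete_measure_uncross[OF assms(1,6) that this WJ(3), of W]
      convolution_le[OF fin WJ(1), of r \<mu> "A \<inter> B"] convolution_le[OF fin WJ(2), of r \<mu> "A \<union> B"]
      Z1(2) Z2(2) WJ(4)
    show ?thesis
      by linarith
  qed
  show ?thesis
    unfolding polymatroid_def mono_on_def
    using assms(1) nonneg mono submodular by blast
qed

end
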